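(* Let $K,N,n,m,p\ge 1$ be integers, let $F_1,\ldots,F_K\in\mathbb{R}^{n\times n}$, $H_1,\ldots,H_K\in\mathbb{R}^{m\times n}$, $G_1,\ldots,G_K\in\mathbb{R}^{n\times p}$, let $Q,P_0\in\mathbb{R}^{n\times n}$ and $R\in\mathbb{R}^{m\times m}$ be (symmetric) positive definite, let $\gamma_N>0$, and let $\hat x_0\in\mathbb{R}^n$. Let $\mathbf{y}^{N-1}=(y_t)_{t=0}^{N-1}$ with $y_t\in\mathbb{R}^m$ and $\mathbf{u}^{N-1}=(u_t)_{t=0}^{N-1}$ with $u_t\in\mathbb{R}^p$ be given. For $i=1,\ldots,K$ define $$P_{0,i}=P_0,\qquad P_{t+1,i}=Q+F_i\bigl(P_{t,i}-P_{t,i}H_i^\top(R+H_iP_{t,i}H_i^\top)^{-1}H_iP_{t,i}\bigr)F_i^\top,$$ and assume that $H_iP_{N,i}H_i^\top\prec\gamma_N^2 I$ for every $i=1,\ldots,K$. Define further $$\breve x_{0,i}=\hat x_0,\qquad \breve x_{t+1,i}=F_i\breve x_{t,i}+K_{t,i}(y_t-H_i\breve x_{t,i})+G_iu_t,\qquad K_{t,i}=F_iP_{t,i}H_i^\top(R+H_iP_{t,i}H_i^\top)^{-1},$$ $$c_{0,i}=0,\qquad c_{t+1,i}=|H_i\breve x_{t,i}-y_t|^2_{(R+H_iP_{t,i}H_i^\top)^{-1}}+c_{t,i}.$$ Then for every $\hat y_N\in\mathbb{R}^m$ the cost $$J_N(\mathbf{y}^{N-1},\mathbf{u}^{N-1},\hat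 y_N)=\sup_{(x_0,\ldots,x_N)\in(\mathbb{R}^n)^{N+1},\ i\in\{1,\ldots,K\}}\Bigl\{|\hat y_N-H_ix_N|^2-\gamma_N^2|x_0-\hat x_0|^2_{P_0^{-1}}-\gamma_N^2\sum_{t=0}^{N-1}\bigl(|x_{t+1}-F_ix_t-G_iu_t|^2_{Q^{-1}}+|y_t-H_ix_t|^2_{R^{-1}}\bigr)\Bigr\}$$ satisfies $$J_N(\mathbf{y}^{N-1},\mathbf{u}^{N-1},\hat y_N)=\max_{i\in\{1,\ldots,K\}}\Bigl\{|\hat y_N-H_i\breve x_{N,i}|^2_{(I-\gamma_N^{-2}H_iP_{N,i}H_i^\top)^{-1}}-\gamma_N^2c_{N,i}\Bigr\}.$$
   Context: For $x\in\mathbb{R}^n$ and a symmetric matrix $A\in\mathbb{R}^{n\times n}$, $|x|_A^2:=x^\top Ax$, and $|x|^2:=x^\top x$. For symmetric matrices, $A\prec B$ means that $B-A$ is positive definite. *)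

theory Defs
  imports "HOL-Analysis.Analysis"
begin

definition pos_def :: "real^'n^'n \<Rightarrow> bool" where
  "pos_def A \<longleftrightarrow> transpose A = A \<and> (\<forall>x. x \<noteq> 0 \<longrightarrow> x \<bullet> (A *v x) > 0)"

definition loewner_less :: "real^'n^'n \<Rightarrow> real^'n^'n \<Rightarrow> bool"  (infix \<open>\<prec>\<^sub>L\<close> 50) where
  "A \<prec>\<^sub>L B \<longleftrightarrow> pos_def (B - A)"

definition wnorm2 :: "real^'n^'n \<Rightarrow> real^'n \<Rightarrow> real" where
  "wnorm2 A x = x \<bullet> (A *v x)"

definition innov_cov :: "real^'n^'m \<Rightarrow> real^'m^'m \<Rightarrow> real^'n^'n \<Rightarrow> real^'m^'m" where
  "innov_cov H R P = R + H ** P ** transpose H"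

primrec riccati ::
  "real^'n^'n \<Rightarrow> real^'n^'m \<Rightarrow> real^'n^'n \<Rightarrow> real^'m^'m \<Rightarrow> real^'n^'n \<Rightarrow> nat \<Rightarrow> real^'n^'n" where
  "riccati F H Q R P0 0 = P0"
| "riccati F H Q R P0 (Suc t) =
     (let P = riccati F H Q R P0 t in
      Q + F ** (P - P ** transpose H ** matrix_inv (innov_cov H R P) ** H ** P) ** transpose F)"

definition gain ::
  "real^'n^'n \<Rightarrow> real^'n^'m \<Rightarrow> real^'n^'n \<Rightarrow> real^'m^'m \<Rightarrow> real^'n^'n \<Rightarrow> nat \<Rightarrow> real^'m^'n" where
  "gain F H Q R P0 t =
     (let P = riccati F H Q R P0 t in F ** P ** transpose H ** matrix_inv (innov_cov H R P))"

primrec observer ::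
  "real^'n^'n \<Rightarrow> real^'n^'m \<Rightarrow> real^'p^'n \<Rightarrow> real^'n^'n \<Rightarrow> real^'m^'m \<Rightarrow> real^'n^'n \<Rightarrow> real^'n
   \<Rightarrow> (nat \<Rightarrow> real^'m) \<Rightarrow> (nat \<Rightarrow> real^'p) \<Rightarrow> nat \<Rightarrow> real^'n" where
  "observer F H G Q R P0 x0hat y u 0 = x0hat"
| "observer F H G Q R P0 x0hat y u (Suc t) =
     (let xb = observer F H G Q R P0 x0hat y u t in
      F *v xb + gain F H Q R P0 t *v (y t - H *v xb) + G *v u t)"

primrec acc_cost ::
  "real^'n^'n \<Rightarrow> real^'n^'m \<Rightarrow> real^'p^'n \<Rightarrow> real^'n^'n \<Rightarrow> real^'m^'m \<Rightarrow> real^'n^'n \<Rightarrow> real^'n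
   \<Rightarrow> (nat \<Rightarrow> real^'m) \<Rightarrow> (nat \<Rightarrow> real^'p) \<Rightarrow> nat \<Rightarrow> real" where
  "acc_cost F H G Q R P0 x0hat y u 0 = 0"
| "acc_cost F H G Q R P0 x0hat y u (Suc t) =
     wnorm2 (matrix_inv (innov_cov H R (riccati F H Q R P0 t)))
       (H *v observer F H G Q R P0 x0hat y u t - y t)
     + acc_cost F H G Q R P0 x0hat y u t"

definition objective ::
  "nat \<Rightarrow> real^'n^'n \<Rightarrow> real^'n^'m \<Rightarrow> real^'p^'n \<Rightarrow> real^'n^'n \<Rightarrow> real^'m^'m \<Rightarrow> real^'n^'n \<Rightarrow> real
   \<Rightarrow> real^'n \<Rightarrow> (nat \<Rightarrow> real^'m) \<Rightarrow> (nat \<Rightarrow> real^'p) \<Rightarrow> real^'m \<Rightarrow> (nat \<Rightarrow> real^'n) \<Rightarrow> real" where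
  "objective N F H G Q R P0 \<gamma> x0hat y u yhat x =
     (norm (yhat - H *v x N))\<^sup>2
     - \<gamma>\<^sup>2 * wnorm2 (matrix_inv P0) (x 0 - x0hat)
     - \<gamma>\<^sup>2 * (\<Sum>t<N. wnorm2 (matrix_inv Q) (x (Suc t) - F *v x t - G *v u t)
                   + wnorm2 (matrix_inv R) (y t - H *v x t))"

text \<open>The supremum is taken in the extended reals, so that equating it with a real number
  asserts its finiteness.\<close>

definition game_cost ::
  "nat \<Rightarrow> nat \<Rightarrow> (nat \<Rightarrow> real^'n^'n) \<Rightarrow> (nat \<Rightarrow> real^'n^'m) \<Rightarrow> (nat \<Rightarrow> real^'p^'n)
   \<Rightarrow> real^'n^'n \<Rightarrow> real^'m^'m \<Rightarrow> real^'n^'n \<Rightarrow> real \<Rightarrow> real^'n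
   \<Rightarrow> (nat \<Rightarrow> real^'m) \<Rightarrow> (nat \<Rightarrow> real^'p) \<Rightarrow> real^'m \<Rightarrow> ereal" where
  "game_cost K N F H G Q R P0 \<gamma> x0hat y u yhat =
     (SUP (x, i) \<in> ({0..N} \<rightarrow>\<^sub>E UNIV) \<times> {1..K}.
        ereal (objective N (F i) (H i) (G i) Q R P0 \<gamma> x0hat y u yhat x))"

end

theory Submission
  imports Defs
begin

text \<open>Fix the model \<open>i\<close> and minimise the disturbance cost over \<open>x\<^sub>0, \<dots>, x\<^sub>t\<^sub>-\<^sub>1\<close> for a prescribed \<open>x\<^sub>t\<close>
  by forward dynamic programming. The value function stays quadratic: it equals \<open>c\<^sub>t\<close> plus the square
  of \<open>x\<^sub>t\<close> minus the observer state, weighted by the inverse of the Riccati matrix \<open>P\<^sub>t\<close>.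
  One completion of squares drives everything: with \<open>R\<close> the measurement weight it absorbs \<open>y\<^sub>t\<close>,
  with \<open>Q\<close> in place of \<open>R\<close> it eliminates \<open>x\<^sub>t\<close> in favour of \<open>x\<^sub>t\<^sub>+\<^sub>1\<close>, and with \<open>- \<gamma>\<^sup>2 I\<close> in place of
  \<open>R\<close> it carries out the final maximisation over \<open>x\<^sub>N\<close>, which is concave because
  \<open>H P\<^sub>N H\<^sup>T \<prec> \<gamma>\<^sup>2 I\<close>. Every optimum is attained, so the supremum is a maximum.\<close>

section \<open>Symmetric matrices, inverses and weighted squares\<close>

lemma wnorm2_pos: "pos_def A \<Longrightarrow> x \<noteq> 0 \<Longrightarrow> wnorm2 A x > 0"
  by (simp add: pos_def_def wnorm2_def)

lemma wnorm2_nonneg: "pos_def A \<Longrightarrow> wnorm2 A x \<ge> 0"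
  by (cases "x = 0") (auto simp: pos_def_def wnorm2_def less_imp_le)

lemma wnorm2_scaleR: "wnorm2 (k *\<^sub>R A) x = k * wnorm2 A x"
  by (simp add: wnorm2_def flip: scaleR_matrix_vector_assoc)

text \<open>\<open>matrix_inv\<close> chooses among two-sided inverses. For square matrices a right
  inverse is two-sided, so there is something to choose, and inverses are unique.\<close>

lemma matrix_inv_eqI:
  fixes A B :: "real^'n^'n"
  assumes "A ** B = mat 1"
  shows "matrix_inv A = B"
proof -
  have "B ** A = mat 1" using assms by (simp add: matrix_left_right_inverse)
  then have "\<exists>A'. A ** A' = mat 1 \<and> A' ** A = mat 1" using assms by blast
  then have "matrix_inv A ** A = mat 1"
    unfolding matrix_inv_def by (rule someI2_ex) simp
  then show ?thesis
    by (metis assms matrix_mul_assoc matrix_mul_lid matrix_mul_rid)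
qed

lemma inner_symmetric_matrix:
  fixes A :: "real^'n^'n"
  assumes "transpose A = A"
  shows "x \<bullet> (A *v y) = (A *v x) \<bullet> y"
  by (metis assms dot_lmul_matrix transpose_matrix_vector)

lemma matrix_add_rdistrib: "(A + B) ** C = A ** C + B ** (C :: real^'n^'m)"
  by (simp add: matrix_matrix_mult_def vec_eq_iff distrib_right sum.distrib)

lemma matrix_diff_ldistrib: "A ** (B - C) = A ** B - A ** (C :: real^'n^'m)"
  by (simp add: matrix_matrix_mult_def vec_eq_iff right_diff_distrib sum_subtractf)

lemma transpose_add: "transpose (A + B) = transpose A + transpose (B :: real^'n^'m)"
  by (simp add: transpose_def vec_eq_iff)

lemma wnorm2_conjugate:
  fixes H :: "real^'n^'m"
  shows "wnorm2 (H ** P ** transpose H) x = wnorm2 P (transpose H *v x)"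
  by (simp add: wnorm2_def matrix_vector_mul_assoc[symmetric] dot_lmul_matrix[symmetric]
      transpose_matrix_vector)

text \<open>For general \<open>H\<close> the conjugated term is merely semidefinite; strictness
  comes from \<open>R\<close>. This serves innovation covariances, information matrices and the
  Riccati step alike.\<close>

lemma pos_def_add_conjugate:
  fixes H :: "real^'n^'m"
  assumes "pos_def R" "pos_def P"
  shows "pos_def (R + H ** P ** transpose H)"
  unfolding pos_def_def
proof (intro conjI allI impI)
  show "transpose (R + H ** P ** transpose H) = R + H ** P ** transpose H"
    using assms by (simp add: pos_def_def transpose_add matrix_transpose_mul matrix_mul_assoc)
  fix x :: "real^'m" assume "x \<noteq> 0"
  then have "wnorm2 R x + wnorm2 P (transpose H *v x) > 0"
    using wnorm2_pos[OF assms(1)] wnorm2_nonneg[OF assms(2)] by (simp add: add_pos_nonneg)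
  then show "x \<bullet> ((R + H ** P ** transpose H) *v x) > 0"
    using wnorm2_conjugate[of H P x]
    by (simp add: wnorm2_def matrix_vector_mult_add_rdistrib inner_add_right)
qed

lemma pos_def_matrix_inv_right:
  assumes "pos_def A"
  shows "A ** matrix_inv A = mat 1"
proof -
  have "\<And>x. A *v x = 0 \<Longrightarrow> x = 0"
    using assms unfolding pos_def_def by (metis inner_zero_right less_irrefl)
  then obtain B where "B ** A = mat 1" using matrix_left_invertible_ker[of A] by blast
  then have "A ** B = mat 1" by (simp add: matrix_left_right_inverse)
  then show ?thesis using matrix_inv_eqI by metis
qed

lemma pos_def_matrix_inv:
  assumes "pos_def A"
  shows "pos_def (matrix_inv A)"
  unfolding pos_def_def
proof (intro conjI allI impI)
  note r = pos_def_matrix_inv_right[OF assms]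
  then have l: "matrix_inv A ** A = mat 1" by (simp add: matrix_left_right_inverse)
  have "A ** transpose (matrix_inv A) = mat 1"
    using arg_cong[OF l, of transpose] assms
    by (simp add: pos_def_def matrix_transpose_mul transpose_mat)
  then show "transpose (matrix_inv A) = matrix_inv A"
    using matrix_inv_eqI by metis
  fix x :: "real^'a" assume "x \<noteq> 0"
  have x: "A *v (matrix_inv A *v x) = x"
    by (simp add: matrix_vector_mul_assoc r)
  with \<open>x \<noteq> 0\<close> have "matrix_inv A *v x \<noteq> 0" by auto
  then have "(matrix_inv A *v x) \<bullet> (A *v (matrix_inv A *v x)) > 0"
    using assms by (simp add: pos_def_def)
  then show "x \<bullet> (matrix_inv A *v x) > 0" by (simp add: x inner_commute)
qed

section \<open>Completion of squares and the two filter updates\<close>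

text \<open>No definiteness is assumed, so that \<open>R = - \<gamma>\<^sup>2 I\<close> is allowed.\<close>

lemma complete_square:
  fixes P P' :: "real^'n^'n" and R R' S' :: "real^'m^'m" and H :: "real^'n^'m"
  assumes "P ** P' = mat 1" "transpose P' = P'"
    and "R ** R' = mat 1" "transpose R' = R'"
    and "(R + H ** P ** transpose H) ** S' = mat 1"
    and d: "d = e - P *v (transpose H *v (S' *v v))"
  shows "wnorm2 P' e + wnorm2 R' (v - H *v e) = wnorm2 S' v + wnorm2 P' d + wnorm2 R' (H *v d)"
proof -
  define s where "s = S' *v v"
  define k where "k = P *v (transpose H *v s)"
  have e: "e = d + k" using d by (simp add: k_def s_def)
  \<comment> \<open>Expressing \<open>v\<close> through \<open>s\<close> lets \<open>R'\<close> undo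
    \<open>R\<close> and \<open>P'\<close> undo \<open>P\<close>; the cross terms between
    \<open>d\<close> and \<open>s\<close> then cancel in the sum.\<close>
  have "v = ((R + H ** P ** transpose H) ** S') *v v" using assms(5) by simp
  also have "\<dots> = R *v s + H *v k"
    by (simp add: s_def k_def matrix_vector_mul_assoc[symmetric] matrix_vector_mult_add_rdistrib)
  finally have v: "v = R *v s + H *v k" .
  have "P' ** P = mat 1" "R' ** R = mat 1"
    using assms by (simp_all add: matrix_left_right_inverse)
  then have P'k: "P' *v k = transpose H *v s" and R's: "R' *v (R *v s) = s"
    by (simp_all add: k_def matrix_vector_mul_assoc matrix_mul_assoc)
  have H: "z \<bullet> (transpose H *v s) = (H *v z) \<bullet> s" for z
    by (metis dot_lmul_matrix inner_commute transpose_matrix_vector)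
  have "k \<bullet> (P' *v d) = (H *v d) \<bullet> s"
    by (metis inner_symmetric_matrix[OF assms(2)] P'k H inner_commute)
  then have "wnorm2 P' e = wnorm2 P' d + 2 * ((H *v d) \<bullet> s) + (H *v k) \<bullet> s"
    by (simp add: wnorm2_def e matrix_vector_right_distrib inner_add_left inner_add_right P'k H
        del: transpose_matrix_vector)
  moreover have "v - H *v e = R *v s - H *v d"
    by (simp add: v e matrix_vector_right_distrib)
  then have "wnorm2 R' (v - H *v e) = (R *v s) \<bullet> s - 2 * ((H *v d) \<bullet> s) + wnorm2 R' (H *v d)"
    using inner_symmetric_matrix[OF assms(4), of "R *v s" "H *v d"]
    by (simp add: wnorm2_def matrix_vector_mult_diff_distrib inner_diff_left inner_diff_right R's
        inner_commute)
  moreover have "wnorm2 S' v = (R *v s) \<bullet> s + (H *v k) \<bullet> s"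
    by (simp add: wnorm2_def s_def[symmetric]) (simp add: v inner_add_left)
  ultimately show ?thesis by simp
qed

text \<open>The Woodbury identity in information form. Definiteness is read off from the sum
  \<open>M\<close>, since it is not visible in the difference \<open>P'\<close>.\<close>

lemma matrix_inv_posterior_cov:
  fixes P :: "real^'n^'n" and R :: "real^'m^'m" and H :: "real^'n^'m"
  assumes "pos_def P" "pos_def R"
  defines "P' \<equiv> P - P ** transpose H ** matrix_inv (innov_cov H R P) ** H ** P"
  defines "M \<equiv> matrix_inv P + transpose H ** matrix_inv R ** H"
  shows "matrix_inv P' = M" "pos_def P'"
proof -
  define S where "S = innov_cov H R P"
  have S: "S ** matrix_inv S = mat 1"
    unfolding S_def innov_cov_def
    by (intro pos_def_matrix_inv_right pos_def_add_conjugate assms)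
  have P: "matrix_inv P ** P = mat 1" and R: "matrix_inv R ** R = mat 1"
    using pos_def_matrix_inv_right assms by (simp_all add: matrix_left_right_inverse)
  have M: "pos_def M"
    using pos_def_add_conjugate[OF pos_def_matrix_inv pos_def_matrix_inv, OF assms(1,2), of "transpose H"]
    by (simp add: M_def)
  \<comment> \<open>Push-through identity: both sides expand to \<open>transpose H + transpose H **
    matrix_inv R ** H ** P ** transpose H\<close>.\<close>
  have "M ** P ** transpose H = transpose H ** matrix_inv R ** S"
    by (simp add: M_def S_def innov_cov_def matrix_add_ldistrib matrix_add_rdistrib P R
        matrix_mul_assoc flip: matrix_mul_assoc[of _ "matrix_inv R" R])
  then have "M ** P ** transpose H ** matrix_inv S = transpose H ** matrix_inv R"
    by (metis S matrix_mul_assoc matrix_mul_rid)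
  then have "M ** P' = M ** P - transpose H ** matrix_inv R ** H ** P"
    by (simp add: P'_def S_def[symmetric] matrix_diff_ldistrib matrix_mul_assoc)
  also have "\<dots> = mat 1"
    by (simp add: M_def matrix_add_rdistrib P)
  finally have *: "M ** P' = mat 1" .
  then have "P' = matrix_inv M" by (simp add: matrix_inv_eqI)
  then show "pos_def P'" using M pos_def_matrix_inv by simp
  show "matrix_inv P' = M"
    using * by (intro matrix_inv_eqI) (simp add: matrix_left_right_inverse)
qed

lemma pos_def_riccati:
  assumes "pos_def Q" "pos_def P0" "pos_def R"
  shows "pos_def (riccati F H Q R P0 t)"
  by (induction t)
    (use assms in \<open>auto simp: Let_def intro!: pos_def_add_conjugate matrix_inv_posterior_cov(2)\<close>)

text \<open>\<open>complete_square\<close> leaves two squares of the same vector; the information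
  form of the posterior covariance merges them into one.\<close>

lemma measurement_update:
  fixes P :: "real^'n^'n" and R :: "real^'m^'m" and H :: "real^'n^'m"
  assumes "pos_def P" "pos_def R"
  shows "wnorm2 (matrix_inv P) e + wnorm2 (matrix_inv R) (v - H *v e) =
    wnorm2 (matrix_inv (innov_cov H R P)) v +
    wnorm2 (matrix_inv (P - P ** transpose H ** matrix_inv (innov_cov H R P) ** H ** P))
      (e - P *v (transpose H *v (matrix_inv (innov_cov H R P) *v v)))"
proof -
  have *: "wnorm2 (matrix_inv P + transpose H ** matrix_inv R ** H) d =
      wnorm2 (matrix_inv P) d + wnorm2 (matrix_inv R) (H *v d)" for d
    using wnorm2_conjugate[of "transpose H" "matrix_inv R" d]
    by (simp add: wnorm2_def matrix_vector_mult_add_rdistrib inner_add_right)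
  have "innov_cov H R P ** matrix_inv (innov_cov H R P) = mat 1"
    unfolding innov_cov_def by (intro pos_def_matrix_inv_right pos_def_add_conjugate assms)
  from complete_square[OF pos_def_matrix_inv_right _ pos_def_matrix_inv_right _
      this[unfolded innov_cov_def] refl, OF assms(1) _ assms(2)]
  show ?thesis
    unfolding matrix_inv_posterior_cov(1)[OF assms] *
    using pos_def_matrix_inv[OF assms(1)] pos_def_matrix_inv[OF assms(2)]
    by (simp add: innov_cov_def pos_def_def)
qed

text \<open>This is \<open>measurement_update\<close> with \<open>F\<close>, \<open>Q\<close>,
  \<open>w\<close> in the roles of \<open>H\<close>, \<open>R\<close>, \<open>v\<close>: the
  remainder is a nonnegative square that vanishes for a suitable \<open>e\<close>.\<close>

lemma time_update:
  fixes P :: "real^'n^'n" and Q :: "real^'m^'m" and F :: "real^'n^'m"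
    and w :: "real^'m"
  assumes "pos_def P" "pos_def Q"
  defines "V \<equiv> wnorm2 (matrix_inv (Q + F ** P ** transpose F)) w"
  shows "V \<le> wnorm2 (matrix_inv P) e + wnorm2 (matrix_inv Q) (w - F *v e)" (is ?bound)
    and "\<exists>e. wnorm2 (matrix_inv P) e + wnorm2 (matrix_inv Q) (w - F *v e) = V" (is ?attained)
proof -
  have *: "wnorm2 (matrix_inv P) e + wnorm2 (matrix_inv Q) (w - F *v e) = V +
      wnorm2 (matrix_inv (P - P ** transpose F ** matrix_inv (innov_cov F Q P) ** F ** P))
        (e - P *v (transpose F *v (matrix_inv (innov_cov F Q P) *v w)))" for e
    using measurement_update[OF assms(1,2)] by (simp add: V_def innov_cov_def)
  have "wnorm2 (matrix_inv (P - P ** transpose F ** matrix_inv (innov_cov F Q P) ** F ** P)) d \<ge> 0" for d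
    by (intro wnorm2_nonneg pos_def_matrix_inv matrix_inv_posterior_cov assms)
  then show ?bound by (simp add: *)
  have "wnorm2 A 0 = 0" for A :: "real^'n^'n" by (simp add: wnorm2_def)
  then show ?attained unfolding * by (metis add.right_neutral diff_self)
qed

section \<open>Forward dynamic programming for one model\<close>

definition disturbance_cost ::
  "real^'n^'n \<Rightarrow> real^'n^'m \<Rightarrow> real^'p^'n \<Rightarrow> real^'n^'n \<Rightarrow> real^'m^'m \<Rightarrow> real^'n^'n \<Rightarrow> real^'n
   \<Rightarrow> (nat \<Rightarrow> real^'m) \<Rightarrow> (nat \<Rightarrow> real^'p) \<Rightarrow> nat \<Rightarrow> (nat \<Rightarrow> real^'n) \<Rightarrow> real" where
  "disturbance_cost F H G Q R P0 x0hat y u N x =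
     wnorm2 (matrix_inv P0) (x 0 - x0hat)
     + (\<Sum>t<N. wnorm2 (matrix_inv Q) (x (Suc t) - F *v x t - G *v u t)
             + wnorm2 (matrix_inv R) (y t - H *v x t))"

text \<open>The Bellman step, by two updates in turn: the measurement update supplies the new
  summand of \<open>c\<close> and the posterior covariance \<open>P'\<close>; the time update
  eliminates \<open>x\<close> and turns \<open>P'\<close> into \<open>P (Suc t)\<close>.\<close>

lemma filter_step:
  fixes F :: "real^'n^'n" and H :: "real^'n^'m" and G :: "real^'p^'n"
    and x0hat :: "real^'n" and y :: "nat \<Rightarrow> real^'m" and u :: "nat \<Rightarrow> real^'p"
  assumes "pos_def Q" "pos_def P0" "pos_def R"
  defines "xb \<equiv> observer F H G Q R P0 x0hat y u"
    and "c \<equiv> acc_cost F H G Q R P0 x0hat y u"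
    and "P \<equiv> riccati F H Q R P0"
  defines "stage \<equiv> \<lambda>t x z. wnorm2 (matrix_inv (P t)) (x - xb t) + c t
      + wnorm2 (matrix_inv Q) (z - F *v x - G *v u t) + wnorm2 (matrix_inv R) (y t - H *v x)"
  defines "V \<equiv> \<lambda>t z. wnorm2 (matrix_inv (P (Suc t))) (z - xb (Suc t)) + c (Suc t)"
  shows "V t z \<le> stage t x z" (is ?bound) and "\<exists>x. stage t x z = V t z" (is ?attained)
proof -
  define S where "S = innov_cov H R (P t)"
  define v where "v = y t - H *v xb t"
  define k where "k = P t *v (transpose H *v (matrix_inv S *v v))"
  define P' where "P' = P t - P t ** transpose H ** matrix_inv S ** H ** P t"
  define w where "w = z - xb (Suc t)"
  have Pt: "pos_def (P t)" unfolding P_def by (intro pos_def_riccati assms)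
  then have P': "pos_def P'"
    unfolding P'_def S_def by (intro matrix_inv_posterior_cov(2) assms)
  \<comment> \<open>The gain is \<open>F\<close> times the correction gain, so the observer predicts
    from the corrected estimate \<open>xb t + k\<close>.\<close>
  have xb: "xb (Suc t) = F *v xb t + F *v k + G *v u t"
    by (simp add: xb_def gain_def Let_def k_def S_def P_def v_def matrix_vector_mul_assoc[symmetric])
  \<comment> \<open>\<open>acc_cost\<close> squares the innovation with the opposite sign.\<close>
  have "wnorm2 (matrix_inv S) (- v) = wnorm2 (matrix_inv S) v"
    by (simp add: wnorm2_def linear_neg[OF matrix_vector_mul_linear])
  then have c: "c (Suc t) = wnorm2 (matrix_inv S) v + c t"
    by (simp add: c_def S_def P_def v_def xb_def)
  have V: "V t z = wnorm2 (matrix_inv (Q + F ** P' ** transpose F)) w + wnorm2 (matrix_inv S) v + c t"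
    by (simp add: V_def c w_def P_def P'_def S_def Let_def)
  \<comment> \<open>With \<open>x\<close> centred at the corrected estimate, the measurement update
    applies to \<open>k + e\<close>, and its remainder is exactly the square of
    \<open>e\<close>.\<close>
  have stage: "stage t (xb t + k + e) z =
      wnorm2 (matrix_inv P') e + wnorm2 (matrix_inv Q) (w - F *v e) + wnorm2 (matrix_inv S) v + c t" for e
  proof -
    have "z - F *v (xb t + k + e) - G *v u t = w - F *v e"
      by (simp add: w_def xb matrix_vector_right_distrib)
    moreover have "y t - H *v (xb t + k + e) = v - H *v (k + e)"
      by (simp add: v_def matrix_vector_right_distrib)
    ultimately show ?thesis
      using measurement_update[OF Pt assms(3), of "k + e" v H]
      by (simp add: stage_def S_def[symmetric] P'_def[symmetric] k_def[symmetric] add.assoc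
          del: transpose_matrix_vector)
  qed
  show ?bound
    using stage[of "x - xb t - k"] time_update(1)[OF P' assms(1), where F = F and w = w and e = "x - xb t - k"]
    by (simp add: V)
  show ?attained
    using stage time_update(2)[OF P' assms(1), where F = F and w = w] unfolding V by metis
qed

lemma disturbance_cost_ge:
  assumes "pos_def Q" "pos_def P0" "pos_def R"
  shows "wnorm2 (matrix_inv (riccati F H Q R P0 N)) (x N - observer F H G Q R P0 x0hat y u N)
    + acc_cost F H G Q R P0 x0hat y u N \<le> disturbance_cost F H G Q R P0 x0hat y u N x"
proof (induction N)
  case 0
  then show ?case by (simp add: disturbance_cost_def)
next
  case (Suc N)
  then show ?case
    using filter_step(1)[OF assms, where t = N and x = "x N" and z = "x (Suc N)" and F = F and H = H
        and G = G and u = u and y = y and x0hat = x0hat]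
    by (simp add: disturbance_cost_def del: riccati.simps observer.simps acc_cost.simps)
qed

text \<open>An optimal trajectory is built backwards from its endpoint: \<open>filter_step\<close>
  gives an optimal predecessor, to which the induction hypothesis is applied, hence the arbitrary
  \<open>z\<close>.\<close>

lemma disturbance_cost_attained:
  assumes "pos_def Q" "pos_def P0" "pos_def R"
  shows "\<exists>x. x N = z \<and> disturbance_cost F H G Q R P0 x0hat y u N x =
    wnorm2 (matrix_inv (riccati F H Q R P0 N)) (z - observer F H G Q R P0 x0hat y u N)
    + acc_cost F H G Q R P0 x0hat y u N"
proof (induction N arbitrary: z)
  case 0
  show ?case by (rule exI[of _ "\<lambda>_. z"]) (simp add: disturbance_cost_def)
next
  case (Suc N)
  obtain x' where x': "wnorm2 (matrix_inv (riccati F H Q R P0 N)) (x' - observer F H G Q R P0 x0hat y u N)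
      + acc_cost F H G Q R P0 x0hat y u N
      + wnorm2 (matrix_inv Q) (z - F *v x' - G *v u N) + wnorm2 (matrix_inv R) (y N - H *v x')
    = wnorm2 (matrix_inv (riccati F H Q R P0 (Suc N))) (z - observer F H G Q R P0 x0hat y u (Suc N))
      + acc_cost F H G Q R P0 x0hat y u (Suc N)"
    using filter_step(2)[OF assms] by blast
  obtain x where x: "x N = x'" "disturbance_cost F H G Q R P0 x0hat y u N x =
      wnorm2 (matrix_inv (riccati F H Q R P0 N)) (x' - observer F H G Q R P0 x0hat y u N)
      + acc_cost F H G Q R P0 x0hat y u N"
    using Suc.IH by blast
  \<comment> \<open>The cost up to \<open>N\<close> reads no entry beyond \<open>x N\<close>, so
    overwriting entry \<open>Suc N\<close> merely appends the last stage.\<close>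
  have "disturbance_cost F H G Q R P0 x0hat y u (Suc N) (x(Suc N := z)) =
    disturbance_cost F H G Q R P0 x0hat y u N x
      + wnorm2 (matrix_inv Q) (z - F *v x N - G *v u N) + wnorm2 (matrix_inv R) (y N - H *v x N)"
    by (simp add: disturbance_cost_def)
  then show ?case using x x' by (intro exI[of _ "x(Suc N := z)"])
      (simp del: riccati.simps observer.simps acc_cost.simps fun_upd_apply add: fun_upd_same)
qed

section \<open>Concave maximisation over the terminal state\<close>

text \<open>Duality: \<open>H P H\<^sup>T \<prec> \<gamma>\<^sup>2 I\<close> implies \<open>H\<^sup>T H \<preceq> \<gamma>\<^sup>2 P\<^sup>-\<^sup>1\<close>, by the Fenchel inequality
  \<open>|d|\<^sup>2 \<ge> 2 q \<bullet> d - q \<bullet> P q\<close> at \<open>q = \<gamma>\<^sup>-\<^sup>2 H\<^sup>T H d\<close>, the norm being weighted by \<open>P\<^sup>-\<^sup>1\<close>.\<close>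

lemma norm_le_of_conjugate_less:
  fixes H :: "real^'n^'m"
  assumes "pos_def P" "H ** P ** transpose H \<prec>\<^sub>L \<gamma>\<^sup>2 *\<^sub>R mat 1" "\<gamma> > 0"
  shows "(norm (H *v d))\<^sup>2 \<le> \<gamma>\<^sup>2 * wnorm2 (matrix_inv P) d"
proof -
  define w where "w = H *v d"
  define q where "q = inverse (\<gamma>\<^sup>2) *\<^sub>R (transpose H *v w)"
  have Pi: "pos_def (matrix_inv P)" using assms pos_def_matrix_inv by blast
  have "matrix_inv P ** P = mat 1"
    using pos_def_matrix_inv_right[OF assms(1)] by (simp add: matrix_left_right_inverse)
  then have PP: "matrix_inv P *v (P *v q) = q" by (simp add: matrix_vector_mul_assoc)
  have "0 \<le> wnorm2 (matrix_inv P) (d - P *v q)" using Pi wnorm2_nonneg by blast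
  also have "\<dots> = wnorm2 (matrix_inv P) d - 2 * (d \<bullet> q) + wnorm2 P q"
    using inner_symmetric_matrix[of "matrix_inv P" "P *v q" d] Pi
    by (simp add: wnorm2_def pos_def_def matrix_vector_mult_diff_distrib inner_diff_left
        inner_diff_right PP inner_commute)
  finally have 1: "2 * (d \<bullet> q) - wnorm2 P q \<le> wnorm2 (matrix_inv P) d" by simp
  have "d \<bullet> (transpose H *v w) = w \<bullet> w"
    unfolding w_def by (metis dot_lmul_matrix inner_commute transpose_matrix_vector)
  then have 2: "\<gamma>\<^sup>2 * (d \<bullet> q) = (norm w)\<^sup>2" 
    using assms(3) by (simp add: q_def power2_norm_eq_inner)
  have "wnorm2 (\<gamma>\<^sup>2 *\<^sub>R mat 1 - H ** P ** transpose H) w \<ge> 0"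
    using assms(2) wnorm2_nonneg unfolding loewner_less_def by blast
  then have "wnorm2 (H ** P ** transpose H) w \<le> \<gamma>\<^sup>2 * (norm w)\<^sup>2"
    by (simp add: wnorm2_def matrix_vector_mult_diff_rdistrib inner_diff_right
        power2_norm_eq_inner scaleR_matrix_vector_assoc[symmetric])
  \<comment> \<open>Here \<open>transpose H *v w\<close> is
    \<open>\<gamma>\<^sup>2 *\<^sub>R q\<close>, and the quadratic form picks up the factor
    twice.\<close>
  moreover have "wnorm2 (H ** P ** transpose H) w = \<gamma>\<^sup>2 * (\<gamma>\<^sup>2 * wnorm2 P q)"
    using assms(3)
    by (simp add: wnorm2_conjugate) (simp add: wnorm2_def q_def matrix_vector_mult_scaleR field_simps)
  ultimately have "\<gamma>\<^sup>2 * (\<gamma>\<^sup>2 * wnorm2 P q) \<le> \<gamma>\<^sup>2 * (norm w)\<^sup>2" by simp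
  then have 3: "\<gamma>\<^sup>2 * wnorm2 P q \<le> (norm w)\<^sup>2"
    by (rule mult_left_le_imp_le) (use assms(3) in simp)
  \<comment> \<open>By \<open>2\<close> and \<open>3\<close> the left side is at least twice the
    squared norm of \<open>w\<close> minus one such square.\<close>
  have "\<gamma>\<^sup>2 * (2 * (d \<bullet> q) - wnorm2 P q) \<le> \<gamma>\<^sup>2 * wnorm2 (matrix_inv P) d"
    using 1 by (intro mult_left_mono) auto
  then show ?thesis using 2 3 by (simp add: w_def algebra_simps)
qed

text \<open>With measurement weight \<open>- \<gamma>\<^sup>2 I\<close> the innovation matrix is a
  negative multiple of \<open>D\<close>. After scaling, the completed square leaves the squared norm
  of \<open>H *v d\<close> minus \<open>\<gamma>\<^sup>2 * wnorm2 (matrix_inv P) d\<close>, which is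
  nonpositive by \<open>norm_le_of_conjugate_less\<close> and zero at \<open>d = 0\<close>.\<close>

lemma terminal_maximisation:
  fixes H :: "real^'n^'m" and v :: "real^'m"
  assumes "pos_def P" "H ** P ** transpose H \<prec>\<^sub>L \<gamma>\<^sup>2 *\<^sub>R mat 1" "\<gamma> > 0"
  defines "V \<equiv> wnorm2 (matrix_inv (mat 1 - inverse (\<gamma>\<^sup>2) *\<^sub>R (H ** P ** transpose H))) v"
  shows "(norm (v - H *v e))\<^sup>2 - \<gamma>\<^sup>2 * wnorm2 (matrix_inv P) e \<le> V" (is ?bound)
    and "\<exists>e. (norm (v - H *v e))\<^sup>2 - \<gamma>\<^sup>2 * wnorm2 (matrix_inv P) e = V" (is ?attained)
proof -
  define D where "D = mat 1 - inverse (\<gamma>\<^sup>2) *\<^sub>R (H ** P ** transpose H)"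
  define S' where "S' = (- inverse (\<gamma>\<^sup>2)) *\<^sub>R matrix_inv D"
  define R where "R = (- \<gamma>\<^sup>2) *\<^sub>R (mat 1 :: real^'m^'m)"
  define R' where "R' = (- inverse (\<gamma>\<^sup>2)) *\<^sub>R (mat 1 :: real^'m^'m)"
  define k where "k = P *v (transpose H *v (S' *v v))"
  have g: "\<gamma>\<^sup>2 \<noteq> 0" using assms(3) by simp
  have "\<gamma>\<^sup>2 *\<^sub>R mat 1 - H ** P ** transpose H = \<gamma>\<^sup>2 *\<^sub>R D"
    using g by (simp add: D_def scaleR_diff_right)
  then have pd: "pos_def (\<gamma>\<^sup>2 *\<^sub>R D)" using assms(2) by (simp add: loewner_less_def)
  \<comment> \<open>The hypothesis makes \<open>\<gamma>\<^sup>2 *\<^sub>R D\<close> positive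
    definite; rescaling its inverse yields a right inverse of \<open>D\<close>.\<close>
  have "D ** (\<gamma>\<^sup>2 *\<^sub>R matrix_inv (\<gamma>\<^sup>2 *\<^sub>R D)) = mat 1"
    using pos_def_matrix_inv_right[OF pd]
    by (simp add: scalar_matrix_assoc matrix_scalar_ac flip: scaleR_scaleR)
  then have D: "D ** matrix_inv D = mat 1" using matrix_inv_eqI by metis
  have "R + H ** P ** transpose H = (- \<gamma>\<^sup>2) *\<^sub>R D"
    using g by (simp add: D_def R_def scaleR_diff_right)
  then have "(R + H ** P ** transpose H) ** S' = (\<gamma>\<^sup>2 * inverse (\<gamma>\<^sup>2)) *\<^sub>R (D ** matrix_inv D)"
    by (simp only: S'_def scalar_matrix_assoc matrix_scalar_ac scaleR_scaleR mult.commute minus_mult_minus)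
  then have S: "(R + H ** P ** transpose H) ** S' = mat 1" using D g by simp
  have "R ** R' = (\<gamma>\<^sup>2 * inverse (\<gamma>\<^sup>2)) *\<^sub>R (mat 1 ** mat 1)"
    by (simp only: R_def R'_def scalar_matrix_assoc matrix_scalar_ac scaleR_scaleR mult.commute
        minus_mult_minus)
  then have R: "R ** R' = mat 1" "transpose R' = R'"
    using g by (simp, simp only: R'_def transpose_scalar transpose_mat)
  have R'n: "\<gamma>\<^sup>2 * wnorm2 R' x = - (norm x)\<^sup>2" for x
    unfolding R'_def wnorm2_scaleR using g by (simp add: wnorm2_def power2_norm_eq_inner)
  have S'V: "\<gamma>\<^sup>2 * wnorm2 S' v = - V"
    unfolding S'_def wnorm2_scaleR using g by (simp add: V_def D_def)
  have "wnorm2 (matrix_inv P) e + wnorm2 R' (v - H *v e) =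
      wnorm2 S' v + wnorm2 (matrix_inv P) (e - k) + wnorm2 R' (H *v (e - k))" for e
    using complete_square[OF pos_def_matrix_inv_right[OF assms(1)] _ R S] 
      pos_def_matrix_inv[OF assms(1)] by (simp add: pos_def_def k_def)
  from arg_cong[OF this, of "\<lambda>r. \<gamma>\<^sup>2 * r"]
  have *: "(norm (v - H *v e))\<^sup>2 - \<gamma>\<^sup>2 * wnorm2 (matrix_inv P) e =
      V + (norm (H *v (e - k)))\<^sup>2 - \<gamma>\<^sup>2 * wnorm2 (matrix_inv P) (e - k)" for e
    unfolding distrib_left R'n S'V by (simp add: algebra_simps)
  show ?bound
    using norm_le_of_conjugate_less[OF assms(1-3), of "e - k"] by (simp add: *)
  show ?attained unfolding * by (intro exI[of _ k]) (simp add: wnorm2_def)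
qed

section \<open>The maximum for one model, then over all models\<close>

lemma objective_eq:
  "objective N F H G Q R P0 \<gamma> x0hat y u yhat x =
    (norm (yhat - H *v x N))\<^sup>2 - \<gamma>\<^sup>2 * disturbance_cost F H G Q R P0 x0hat y u N x"
  by (simp add: objective_def disturbance_cost_def algebra_simps)

text \<open>The disturbance cost enters with a negative factor, so its lower bound gives an upper
  bound here. Equality comes from an optimal terminal error \<open>e\<close> and an optimal
  trajectory ending at \<open>xb + e\<close>.\<close>

lemma objective_maximum:
  fixes F :: "real^'n^'n" and H :: "real^'n^'m" and G :: "real^'p^'n"
    and x0hat :: "real^'n" and y :: "nat \<Rightarrow> real^'m" and u :: "nat \<Rightarrow> real^'p" and yhat :: "real^'m"
  assumes "pos_def Q" "pos_def P0" "pos_def R" "\<gamma> > 0"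
    and "H ** riccati F H Q R P0 N ** transpose H \<prec>\<^sub>L \<gamma>\<^sup>2 *\<^sub>R mat 1"
  defines "V \<equiv> wnorm2 (matrix_inv (mat 1 - inverse (\<gamma>\<^sup>2) *\<^sub>R
                (H ** riccati F H Q R P0 N ** transpose H)))
        (yhat - H *v observer F H G Q R P0 x0hat y u N)
      - \<gamma>\<^sup>2 * acc_cost F H G Q R P0 x0hat y u N"
  shows "objective N F H G Q R P0 \<gamma> x0hat y u yhat x \<le> V" (is ?bound)
    and "\<exists>x \<in> {0..N} \<rightarrow>\<^sub>E UNIV. objective N F H G Q R P0 \<gamma> x0hat y u yhat x = V" (is ?attained)
proof -
  define xb where "xb = observer F H G Q R P0 x0hat y u N"
  define P where "P = riccati F H Q R P0 N"
  define c where "c = acc_cost F H G Q R P0 x0hat y u N"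
  have "pos_def P" unfolding P_def by (intro pos_def_riccati assms)
  note max = terminal_maximisation[OF this assms(5)[folded P_def] assms(4), of "yhat - H *v xb"]
  have split: "yhat - H *v z = yhat - H *v xb - H *v (z - xb)" for z
    by (simp add: matrix_vector_mult_diff_distrib)
  have "\<gamma>\<^sup>2 * (wnorm2 (matrix_inv P) (x N - xb) + c)
      \<le> \<gamma>\<^sup>2 * disturbance_cost F H G Q R P0 x0hat y u N x"
    unfolding P_def xb_def c_def by (intro mult_left_mono disturbance_cost_ge assms) auto
  then show ?bound
    using max(1)[of "x N - xb"]
    by (simp add: objective_eq V_def P_def[symmetric] xb_def[symmetric] c_def[symmetric]
        split[of "x N"] distrib_left)
  obtain e where e: "(norm (yhat - H *v xb - H *v e))\<^sup>2 - \<gamma>\<^sup>2 * wnorm2 (matrix_inv P) e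
      = V + \<gamma>\<^sup>2 * c"
    using max(2) by (auto simp: V_def P_def xb_def c_def)
  obtain x where x: "x N = xb + e" "disturbance_cost F H G Q R P0 x0hat y u N x =
      wnorm2 (matrix_inv P) e + c"
    using disturbance_cost_attained[OF assms(1-3), of N "xb + e" F H G x0hat y u]
    by (auto simp: P_def xb_def c_def)
  have "objective N F H G Q R P0 \<gamma> x0hat y u yhat x = V"
    using e by (simp add: objective_eq x split[of "xb + e"] distrib_left)
  \<comment> \<open>The supremum ranges over functions that are \<open>undefined\<close> beyond
    \<open>N\<close>; restriction changes no entry that the objective reads.\<close>
  moreover have "objective N F H G Q R P0 \<gamma> x0hat y u yhat (restrict x {0..N}) =
      objective N F H G Q R P0 \<gamma> x0hat y u yhat x"
    by (simp add: objective_def)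
  ultimately show ?attained by (intro bexI[of _ "restrict x {0..N}"]) auto
qed

theorem theorem1:
  fixes K N :: nat
    and F :: "nat \<Rightarrow> real^'n^'n"
    and H :: "nat \<Rightarrow> real^'n^'m"
    and G :: "nat \<Rightarrow> real^'p^'n"
    and Q P0 :: "real^'n^'n"
    and R :: "real^'m^'m"
    and \<gamma> :: real
    and x0hat :: "real^'n"
    and y :: "nat \<Rightarrow> real^'m"
    and u :: "nat \<Rightarrow> real^'p"
    and yhat :: "real^'m"
  assumes "K \<ge> 1" and "N \<ge> 1"
    and "pos_def Q" and "pos_def P0" and "pos_def R"
    and "\<gamma> > 0"
    and "\<And>i. i \<in> {1..K} \<Longrightarrow>
           H i ** riccati (F i) (H i) Q R P0 N ** transpose (H i) \<prec>\<^sub>L \<gamma>\<^sup>2 *\<^sub>R mat 1"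
  shows "game_cost K N F H G Q R P0 \<gamma> x0hat y u yhat =
    ereal (MAX i\<in>{1..K}.
      wnorm2 (matrix_inv (mat 1 - inverse (\<gamma>\<^sup>2) *\<^sub>R
                (H i ** riccati (F i) (H i) Q R P0 N ** transpose (H i))))
        (yhat - H i *v observer (F i) (H i) (G i) Q R P0 x0hat y u N)
      - \<gamma>\<^sup>2 * acc_cost (F i) (H i) (G i) Q R P0 x0hat y u N)"
    (is "_ = ereal (MAX i\<in>_. ?V i)")
proof -
  note max = objective_maximum[OF assms(3-6) assms(7)]
  have fin: "finite (?V ` {1..K})" "?V ` {1..K} \<noteq> {}" using assms(1) by auto
  \<comment> \<open>A best model \<open>j\<close> exists as \<open>K\<close> is at least 1; its
    optimal trajectory will show that the supremum reaches the maximum.\<close>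
  obtain j where j: "j \<in> {1..K}" "(MAX i\<in>{1..K}. ?V i) = ?V j"
    using Max_in[OF fin] by blast
  show ?thesis
    unfolding game_cost_def
  proof (rule antisym)
    show "(SUP (x, i)\<in>({0..N} \<rightarrow>\<^sub>E UNIV) \<times> {1..K}.
        ereal (objective N (F i) (H i) (G i) Q R P0 \<gamma> x0hat y u yhat x))
      \<le> ereal (MAX i\<in>{1..K}. ?V i)"
    proof (rule SUP_least, clarify)
      fix x i assume i: "i \<in> {1..K}"
      have "objective N (F i) (H i) (G i) Q R P0 \<gamma> x0hat y u yhat x \<le> ?V i" by (rule max(1)[OF i])
      also have "\<dots> \<le> (MAX i\<in>{1..K}. ?V i)" using i fin by (intro Max_ge) auto
      finally show "ereal (objective N (F i) (H i) (G i) Q R P0 \<gamma> x0hat y u yhat x)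
        \<le> ereal (MAX i\<in>{1..K}. ?V i)" by simp
    qed
    obtain x where "x \<in> {0..N} \<rightarrow>\<^sub>E UNIV"
        "objective N (F j) (H j) (G j) Q R P0 \<gamma> x0hat y u yhat x = ?V j"
      using max(2)[OF j(1)] by blast
    then show "ereal (MAX i\<in>{1..K}. ?V i)
      \<le> (SUP (x, i)\<in>({0..N} \<rightarrow>\<^sub>E UNIV) \<times> {1..K}.
        ereal (objective N (F i) (H i) (G i) Q R P0 \<gamma> x0hat y u yhat x))"
      using j by (intro SUP_upper2[of "(x, j)"]) auto
  qed
qed

end
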